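(* Let $G$ be an undirected graph with adjacency matrix $A_G$ and denote the smallest and largest eigenvalue of $A_G$ by $\lambda_{\min}$ and $\lambda_{\max}$, respectively. Further, let $E_{ij}=\mathbf e_i\mathbf e_j^T\in\mathbb{R}^{n\times n}$ and denote $m(u,v):=d(u,i)+d(j,v)$. Then, if $\sqrt{\lambda_{\max}-\lambda_{\min}}\le m(u,v)\le \frac{\lambda_{\max}-\lambda_{\min}}{2}$, we have the bound $$|[L_{\exp}(A_G,E_{ij})]_{uv}| \le 2\,\frac{\lambda_{\max}-\lambda_{\min}}{m(u,v)}\; e^{\lambda_{\max}-\frac{4m(u,v)^2}{5(\lambda_{\max}-\lambda_{\min})}},$$ and if $m(u,v) > \frac{\lambda_{\max}-\lambda_{\min}}{2}$, we have the bound $$|[L_{\exp}(A_G,E_{ij})]_{uv}| \le 8\,\frac{e^{\lambda_{\max}}\cdot m(u,v)}{\lambda_{\max}-\lambda_{\min}}\left(\frac{e\cdot(\lambda_{\max}-\lambda_{\min})}{4m(u,v)+2(\lambda_{\max}-\lambda_{\min})}\right)^{m(u,v)}.$$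
   Context: An undirected (possibly weighted) graph $G$ has node set $\mathcal V=\{1,\dots,n\}$, a symmetric edge set $\mathcal E\subseteq\mathcal V\times\mathcal V$ (no self loops, no multiple edges) and symmetric weights $w_{ij}=w_{ji}>0$ for $(i,j)\in\mathcal E$ (all equal to $1$ if unweighted). Its adjacency matrix $A_G\in\mathbb{R}^{n\times n}$, with entries $a_{ij}=w_{ij}$ if $(i,j)\in\mathcal E$ and $0$ otherwise, is symmetric. $i,j,u,v$ are nodes of $G$. $d(u,v)$ is the geodesic distance in $G$: the smallest number of edges on any path connecting node $u$ to node $v$. $\mathbf e_i$ is the $i$th canonical unit vector of $\mathbb{R}^n$, and $[M]_{uv}$ is the $(u,v)$ entry of a matrix $M$. $L_{\exp}(A,\cdot)$ is the Fréchet derivative of the matrix exponential at $A$: the linear operator satisfying $\exp(A+E)-\exp(A)=L_{\exp}(A,E)+o(\|E\|)$ for all $E\in\mathbb{R}^{n\times n}$. *)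

theory Defs
  imports
    "HOL-Analysis.Analysis"
    "HOL-Library.Extended_Nat"
    "Graph_Theory.Pair_Digraph"
begin

text \<open>
  Undirected graphs are those of \<^locale>\<open>pair_graph\<close>: finite, no loops, and every edge
  \<open>{u, v}\<close> is present as both arcs \<open>(u, v)\<close> and \<open>(v, u)\<close>; having pairs as arcs excludes
  multiple edges. The nodes are all elements of the finite type \<^typ>\<open>'n\<close>, which also indexes
  the rows and columns of the matrices. The unweighted case is \<open>w = (\<lambda>_ _. 1)\<close>.
\<close>
definition weighted_graph :: "'n::finite pair_pre_digraph \<Rightarrow> ('n \<Rightarrow> 'n \<Rightarrow> real) \<Rightarrow> bool" where
  "weighted_graph G w \<longleftrightarrow>
     pair_graph G \<and> pverts G = UNIV \<and> (\<forall>(i, j) \<in> parcs G. w i j > 0 \<and> w i j = w j i)"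

definition adjacency_matrix ::
    "'n::finite pair_pre_digraph \<Rightarrow> ('n \<Rightarrow> 'n \<Rightarrow> real) \<Rightarrow> real^'n^'n" where
  "adjacency_matrix G w = (\<chi> i j. if (i, j) \<in> parcs G then w i j else 0)"

text \<open>The value is \<open>\<infinity>\<close> when no path connects \<open>u\<close> to \<open>v\<close>.\<close>
definition geodesic_dist :: "'n pair_pre_digraph \<Rightarrow> 'n \<Rightarrow> 'n \<Rightarrow> enat" where
  "geodesic_dist G u v = (INF p \<in> {p. pre_digraph.apath (with_proj G) u p v}. enat (length p))"

text \<open>
  Only real eigenvalues are collected; the definitions are used for symmetric matrices, all of
  whose eigenvalues are real.
\<close>
definition eigenvalues :: "real^'n^'n \<Rightarrow> real set" where
  "eigenvalues A = {l. \<exists>x. x \<noteq> 0 \<and> A *v x = l *\<^sub>R x}"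

definition lambda_min :: "real^'n^'n \<Rightarrow> real" where
  "lambda_min A = Min (eigenvalues A)"

definition lambda_max :: "real^'n^'n \<Rightarrow> real" where
  "lambda_max A = Max (eigenvalues A)"

text \<open>
  The class operations \<open>*\<close> and \<open>^\<close> on \<^typ>\<open>real^'n^'n\<close> act componentwise, and \<^const>\<open>exp\<close> is not
  available on this type, so the power and the exponential series are defined from \<open>**\<close>.
\<close>
primrec matrix_pow :: "real^'n^'n \<Rightarrow> nat \<Rightarrow> real^'n^'n" where
  "matrix_pow A 0 = mat 1"
| "matrix_pow A (Suc k) = A ** matrix_pow A k"

definition matrix_exp :: "real^'n^'n \<Rightarrow> real^'n^'n" where
  "matrix_exp A = (\<Sum>k. (1 / fact k) *\<^sub>R matrix_pow A k)"

definition L_exp :: "real^'n^'n \<Rightarrow> real^'n^'n \<Rightarrow> real^'n^'n" where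
  "L_exp A = frechet_derivative matrix_exp (at A)"

definition unit_matrix :: "'n \<Rightarrow> 'n \<Rightarrow> real^'n^'n" where
  "unit_matrix i j =
     (columnvector (axis i 1) :: real^1^'n) ** (rowvector (axis j 1) :: real^'n^1)"

end

theory Submission
  imports Defs
begin

text \<open>
  The entry of the Frechet derivative is \<open>\<Sum>n. 1/n! \<Sum>p+q=n-1. (A^p)_ui (A^q)_jv\<close>, whose terms with
  \<open>p + q < m(u,v)\<close> vanish because \<open>(A^p)_ui = 0\<close> for \<open>p < d(u,i)\<close>. Hence it is bounded by the error
  of the best uniform approximation of \<open>exp\<close> on \<open>[\<lambda>_min, \<lambda>_max]\<close> by polynomials of degree less than
  \<open>m\<close>. With \<open>D = \<lambda>_max - \<lambda>_min\<close>, truncating the Chebyshev expansion shows that this error is at most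
  \<open>2 exp (\<lambda>_max - D/2 + D/4 (r + 1/r)) / r^m\<close> for every \<open>r \<ge> 1\<close>. The two bounds arise from
  \<open>r = 1 + 2m/D\<close> and \<open>r = 4m/D\<close>.
\<close>

section \<open>Polynomial approximation of the exponential\<close>

text \<open>Turns an approximation of \<open>exp\<close> by \<open>q\<close> into control of the
  derivative of \<open>exp - P\<close>; the coefficients are integrated term by term.\<close>

lemma ex_poly_antiderivative:
  fixes q :: "'a::field_char_0 poly"
  shows "\<exists>P. pderiv P = q \<and> degree P \<le> Suc (degree q)"
proof (intro exI conjI)
  let ?P = "\<Sum>i\<le>degree q. monom (coeff q i / of_nat (Suc i)) (Suc i)"
  have "pderiv ?P = (\<Sum>i\<le>degree q. monom (coeff q i) i)"
    by (simp add: higher_pderiv_sum[of 1, simplified] pderiv_monom del: of_nat_Suc)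
  then show "pderiv ?P = q"
    by (simp add: poly_as_sum_of_monoms)
  show "degree ?P \<le> Suc (degree q)"
    by (rule degree_sum_le) (auto intro: order_trans[OF degree_monom_le])
qed

section \<open>Chebyshev polynomials and powers of the cosine\<close>

lemma ex_cos_multiple_poly:
  "\<exists>p::real poly. degree p \<le> n \<and> (\<forall>t. poly p (cos t) = cos (real n * t))"
proof (induction n rule: less_induct)
  case (less n)
  consider "n = 0" | "n = 1" | k where "n = Suc (Suc k)"
    by (metis One_nat_def not0_implies_Suc)
  then show ?case
  proof cases
    case 1
    then show ?thesis by (intro exI[of _ 1]) simp
  next
    case 2
    then show ?thesis by (intro exI[of _ "[:0, 1:]"]) simp
  next
    case 3
    obtain p where p: "degree p \<le> k" "\<And>t. poly p (cos t) = cos (real k * t)"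
      using less.IH[of k] 3 by auto
    obtain q where q: "degree q \<le> Suc k" "\<And>t. poly q (cos t) = cos (real (Suc k) * t)"
      using less.IH[of "Suc k"] 3 by auto
    show ?thesis
    proof (intro exI conjI allI)
      show "degree ([:0, 2:] * q - p) \<le> n"
        using p(1) q(1) 3 degree_mult_le[of "[:0, 2:]" q]
        by (intro degree_diff_le) auto
      show "poly ([:0, 2:] * q - p) (cos t) = cos (real n * t)" for t
      proof -
        \<comment> \<open>This product formula is the three-term recurrence of the Chebyshev
          polynomials.\<close>
        have "2 * cos t * cos (real (Suc k) * t)
            = cos (real (Suc k) * t + t) + cos (real (Suc k) * t - t)"
          by (simp add: cos_add cos_diff)
        then show ?thesis
          using p(2)[of t] q(2)[of t] 3 by (simp add: algebra_simps)
      qed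
    qed
  qed
qed

text \<open>Since \<open>2 * cos t\<close> is \<open>cis t + cis (- t)\<close>, this is the real
  part of a binomial expansion. The frequency \<open>2 k - n\<close> is the endpoint of an
  \<open>n\<close>-step simple walk with \<open>k\<close> steps up.\<close>

lemma two_cos_power:
  "(2 * cos t) ^ n = (\<Sum>k\<le>n. real (n choose k) * cos ((2 * real k - real n) * t))"
proof -
  have "complex_of_real (2 * cos t) = cis t + cis (- t)"
    by (simp add: complex_eq_iff)
  then have "complex_of_real ((2 * cos t) ^ n) = (cis t + cis (- t)) ^ n"
    by (simp only: of_real_power)
  also have "\<dots> = (\<Sum>k\<le>n. of_nat (n choose k) * cis ((2 * real k - real n) * t))"
    unfolding binomial_ring
  proof (rule sum.cong)
    fix k assume "k \<in> {..n}"
    then have "cis t ^ k * cis (- t) ^ (n - k) = cis ((2 * real k - real n) * t)"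
      by (simp add: Complex.DeMoivre cis_mult of_nat_diff algebra_simps)
    then show "of_nat (n choose k) * cis t ^ k * cis (- t) ^ (n - k)
        = of_nat (n choose k) * cis ((2 * real k - real n) * t)"
      by (simp add: mult.assoc)
  qed simp
  finally have "Re (complex_of_real ((2 * cos t) ^ n))
      = Re (\<Sum>k\<le>n. of_nat (n choose k) * cis ((2 * real k - real n) * t))"
    by simp
  then show ?thesis
    by simp
qed

text \<open>Chernoff's argument: on the tail, one of \<open>r^(2k-n)\<close> and
  \<open>r^(n-2k)\<close> is at least \<open>r^m\<close>, and either of them, summed against the
  binomial coefficients, gives \<open>(r + 1/r)^n\<close>.\<close>

lemma binomial_tail_le:
  fixes r :: real
  assumes "r \<ge> 1"
  shows "(\<Sum>k | k \<le> n \<and> m \<le> nat \<bar>2 * int k - int n\<bar>. real (n choose k))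
           \<le> 2 * (r + 1 / r) ^ n / r ^ m"
proof -
  define S where "S = {k. k \<le> n \<and> m \<le> nat \<bar>2 * int k - int n\<bar>}"
  \<comment> \<open>This is \<open>r^(2k-n) + r^(n-2k)\<close>, written with natural
    exponents.\<close>
  define g where "g k = r ^ k * (1 / r) ^ (n - k) + r ^ (n - k) * (1 / r) ^ k" for k
  have r: "r > 0" using assms by simp
  have g0: "g k \<ge> 0" for k
    using r by (simp add: g_def)
  have large: "r ^ m \<le> r ^ a * (1 / r) ^ b" if "a \<ge> m + b" for a b
  proof -
    have "r ^ m * r ^ b \<le> r ^ a"
      unfolding power_add[symmetric] using that assms by (intro power_increasing) auto
    then show ?thesis
      using r by (simp add: power_divide field_simps)
  qed
  have one: "r ^ m \<le> g k" if "k \<in> S" for k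
  proof (cases "k \<ge> m + (n - k)")
    case True
    then show ?thesis
      using large[OF True] r by (simp add: g_def add_increasing2)
  next
    case False
    then have "n - k \<ge> m + k"
      using that by (auto simp: S_def)
    then show ?thesis
      using large[of k "n - k"] r by (simp add: g_def add_increasing)
  qed
  have "(\<Sum>k\<in>S. real (n choose k)) * r ^ m \<le> (\<Sum>k\<in>S. real (n choose k) * g k)"
    unfolding sum_distrib_right by (intro sum_mono mult_left_mono one) auto
  also have "\<dots> \<le> (\<Sum>k\<le>n. real (n choose k) * g k)"
    by (intro sum_mono2) (auto simp: S_def g0)
  also have "\<dots> = (r + 1 / r) ^ n + (1 / r + r) ^ n"
    unfolding binomial_ring g_def by (simp add: algebra_simps sum.distrib)
  also have "\<dots> = 2 * (r + 1 / r) ^ n"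
    by (simp add: add.commute)
  finally show ?thesis
    using r by (simp add: S_def pos_le_divide_eq)
qed

section \<open>Partial sums and tails of the exponential series\<close>

lemma sums_real_exp: "(\<lambda>n. x ^ n / fact n) sums exp x" for x :: real
  using exp_converges[of x] by (simp add: divide_inverse mult.commute)

lemma exp_partial_sum_le:
  fixes x :: real
  assumes "x \<ge> 0"
  shows "(\<Sum>n<N. x ^ n / fact n) \<le> exp x"
  using assms sums_real_exp[of x] sum_le_suminf[of "\<lambda>n. x ^ n / fact n" "{..<N}"]
  by (simp add: sums_iff)

text \<open>The tail at \<open>x\<close> is dominated termwise by the tail at \<open>y\<close>, so
  one cutoff \<open>N\<close> serves a whole interval.\<close>

lemma exp_minus_partial_sum_le:
  fixes x y :: real
  assumes "\<bar>x\<bar> \<le> y"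
  shows "\<bar>exp x - (\<Sum>n<N. x ^ n / fact n)\<bar> \<le> exp y - (\<Sum>n<N. y ^ n / fact n)"
proof -
  have tail: "(\<lambda>n. z ^ (n + N) / fact (n + N)) sums (exp z - (\<Sum>n<N. z ^ n / fact n))" for z :: real
    using sums_split_initial_segment[OF sums_real_exp, of z N] .
  show ?thesis
    unfolding real_norm_def[symmetric]
  proof (rule norm_sums_le[OF tail tail])
    show "norm (x ^ (n + N) / fact (n + N)) \<le> y ^ (n + N) / fact (n + N)" for n
      using assms by (simp add: power_abs divide_right_mono power_mono)
  qed
qed

text \<open>
  With \<open>x = cos t\<close>, expand each power \<open>(2 x) ^ n\<close> of the exponential series into cosines of
  multiples of \<open>t\<close>, that is, into Chebyshev polynomials of \<open>x\<close>, and drop those of degree at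
  least \<open>m\<close>. The dropped coefficients sum to a Poisson mixture of tails of simple random walks,
  whence the Chernoff factor \<open>exp (c * (r + 1 / r)) / r ^ m\<close>; \<open>e\<close> absorbs the tail of the series.
\<close>
lemma exp_poly_approx_symmetric:
  fixes c r e :: real
  assumes "c \<ge> 0" "r \<ge> 1" "m > 0" "e > 0"
  shows "\<exists>q. degree q < m \<and>
    (\<forall>x\<in>{-1..1}. \<bar>exp (2 * c * x) - poly q x\<bar> \<le> 2 * exp (c * (r + 1 / r)) / r ^ m + e)"
proof -
  define idx where "idx n k = nat \<bar>2 * int k - int n\<bar>" for n k
  obtain T :: "nat \<Rightarrow> real poly"
    where degT: "\<And>n. degree (T n) \<le> n" and T: "\<And>n t. poly (T n) (cos t) = cos (real n * t)"
    using ex_cos_multiple_poly by metis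
  have Tidx: "poly (T (idx n k)) (cos t) = cos ((2 * real k - real n) * t)" for n k t
  proof -
    have "real (idx n k) = \<bar>2 * real k - real n\<bar>"
      unfolding idx_def by simp
    \<comment> \<open>Cosine is even, so the absolute value in \<open>idx\<close> is
      harmless.\<close>
    then show ?thesis
      by (cases "2 * real k \<ge> real n") (simp_all add: T abs_if minus_diff_eq[symmetric, of "2 * real k"] del: minus_diff_eq)
  qed
  have "(\<lambda>N. \<Sum>n<N. (2 * c) ^ n / fact n) \<longlonglongrightarrow> exp (2 * c)"
    using sums_real_exp[of "2 * c"] by (simp add: sums_def)
  \<comment> \<open>\<open>N\<close> is chosen at the endpoint \<open>x = 1\<close>, whose tail
    dominates the tails at all other \<open>x\<close>.\<close>
  from LIMSEQ_D[OF this \<open>e > 0\<close>]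
  obtain N where N: "\<bar>(\<Sum>n<N. (2 * c) ^ n / fact n) - exp (2 * c)\<bar> < e"
    by auto
  define q where "q = (\<Sum>n<N. smult (c ^ n / fact n)
      (\<Sum>k | k \<le> n \<and> idx n k < m. smult (real (n choose k)) (T (idx n k))))"
  have "degree q \<le> m - 1"
    unfolding q_def
    by (intro degree_sum_le order_trans[OF degree_smult_le] order_trans[OF degT]) auto
  then have "degree q < m"
    using \<open>m > 0\<close> by simp
  moreover have "\<bar>exp (2 * c * x) - poly q x\<bar> \<le> 2 * exp (c * (r + 1 / r)) / r ^ m + e"
    if "x \<in> {-1..1}" for x
  proof -
    define t where "t = arccos x"
    have x: "x = cos t"
      using that by (simp add: t_def)
    define h where "h n k = real (n choose k) * cos ((2 * real k - real n) * t)" for n k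
    have q: "poly q x = (\<Sum>n<N. c ^ n / fact n * (\<Sum>k | k \<le> n \<and> idx n k < m. h n k))"
      by (simp add: q_def x poly_sum Tidx h_def)
    have split: "(2 * cos t) ^ n - (\<Sum>k | k \<le> n \<and> idx n k < m. h n k)
        = (\<Sum>k | k \<le> n \<and> m \<le> idx n k. h n k)" for n
    proof -
      have "(2 * cos t) ^ n = (\<Sum>k\<le>n. h n k)"
        by (simp only: two_cos_power h_def)
      also have "\<dots> = (\<Sum>k\<in>{k. k \<le> n \<and> idx n k < m} \<union> {k. k \<le> n \<and> m \<le> idx n k}. h n k)"
        by (rule sum.cong) auto
      also have "\<dots> = (\<Sum>k | k \<le> n \<and> idx n k < m. h n k) + (\<Sum>k | k \<le> n \<and> m \<le> idx n k. h n k)"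
        by (rule sum.union_disjoint) auto
      finally show ?thesis by simp
    qed
    have tail: "\<bar>\<Sum>k | k \<le> n \<and> m \<le> idx n k. h n k\<bar> \<le> 2 * (r + 1 / r) ^ n / r ^ m" for n
    proof -
      have "\<bar>\<Sum>k | k \<le> n \<and> m \<le> idx n k. h n k\<bar>
          \<le> (\<Sum>k | k \<le> n \<and> m \<le> idx n k. real (n choose k))"
        unfolding h_def by (intro order_trans[OF sum_abs] sum_mono) (simp add: abs_mult mult_left_le)
      also have "\<dots> \<le> 2 * (r + 1 / r) ^ n / r ^ m"
        unfolding idx_def by (rule binomial_tail_le[OF \<open>r \<ge> 1\<close>])
      finally show ?thesis .
    qed
    have "(\<Sum>n<N. (2 * c * x) ^ n / fact n) - poly q x
        = (\<Sum>n<N. c ^ n / fact n * (\<Sum>k | k \<le> n \<and> m \<le> idx n k. h n k))"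
      unfolding q split[symmetric]
      by (simp add: x sum_subtractf power_mult_distrib algebra_simps)
    also have "\<bar>\<dots>\<bar> \<le> (\<Sum>n<N. c ^ n / fact n * (2 * (r + 1 / r) ^ n / r ^ m))"
      using \<open>c \<ge> 0\<close> tail
      by (intro order_trans[OF sum_abs] sum_mono) (auto simp: abs_mult simp del: times_divide_eq_left times_divide_eq_right intro!: mult_left_mono)
    also have "\<dots> = (\<Sum>n<N. (c * (r + 1 / r)) ^ n / fact n) * (2 / r ^ m)"
      by (simp add: sum_distrib_left sum_divide_distrib power_mult_distrib mult_ac)
    also have "\<dots> \<le> exp (c * (r + 1 / r)) * (2 / r ^ m)"
      using assms by (intro mult_right_mono exp_partial_sum_le) auto
    finally have 1: "\<bar>(\<Sum>n<N. (2 * c * x) ^ n / fact n) - poly q x\<bar> \<le> 2 * exp (c * (r + 1 / r)) / r ^ m"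
      by (simp add: mult.commute)
    have "\<bar>2 * c * x\<bar> \<le> 2 * c"
      using that \<open>c \<ge> 0\<close> by (auto simp: abs_mult mult_left_le abs_le_iff)
    from exp_minus_partial_sum_le[OF this, of N] N
    have 2: "\<bar>exp (2 * c * x) - (\<Sum>n<N. (2 * c * x) ^ n / fact n)\<bar> \<le> e"
      by linarith
    show ?thesis
      using 1 2 by linarith
  qed
  ultimately show ?thesis by blast
qed

text \<open>Affine change of variable \<open>x = s + 2 * c * y\<close> with midpoint
  \<open>s\<close> and half-length \<open>2 * c\<close>. As
  \<open>exp x = exp s * exp (2 * c * y)\<close>, the slack passed on is \<open>e / exp s\<close>. A
  one-point interval is treated apart, since the substitution divides by its length.\<close>

lemma exp_poly_approx:
  fixes a b r e :: real
  assumes "a \<le> b" "r \<ge> 1" "m > 0" "e > 0"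
  shows "\<exists>q. degree q < m \<and> (\<forall>x\<in>{a..b}. \<bar>exp x - poly q x\<bar>
           \<le> 2 * exp (b - (b - a) / 2 + (b - a) / 4 * (r + 1 / r)) / r ^ m + e)"
proof (cases "a = b")
  case True
  then show ?thesis
    using assms by (intro exI[of _ "[:exp a:]"]) (auto intro!: add_nonneg_nonneg)
next
  case False
  define c where "c = (b - a) / 4"
  define s where "s = (a + b) / 2"
  have c: "c > 0" using False \<open>a \<le> b\<close> by (simp add: c_def)
  obtain q where q: "degree q < m" and approx: "\<And>x. x \<in> {-1..1} \<Longrightarrow>
      \<bar>exp (2 * c * x) - poly q x\<bar> \<le> 2 * exp (c * (r + 1 / r)) / r ^ m + e / exp s"
    using exp_poly_approx_symmetric[of c r m "e / exp s"] c assms by auto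
  define p where "p = smult (exp s) (q \<circ>\<^sub>p [:- s / (2 * c), 1 / (2 * c):])"
  have "degree p < m"
    using q c by (simp add: p_def degree_pcompose)
  moreover have "\<bar>exp x - poly p x\<bar> \<le> 2 * exp (b - (b - a) / 2 + (b - a) / 4 * (r + 1 / r)) / r ^ m + e"
    if "x \<in> {a..b}" for x
  proof -
    define y where "y = (x - s) / (2 * c)"
    have y: "y \<in> {-1..1}"
      using that c by (auto simp: y_def c_def s_def field_simps)
    have x: "x = s + 2 * c * y"
      using c by (simp add: y_def)
    have "poly p x = exp s * poly q y"
      by (simp add: p_def poly_pcompose y_def diff_divide_distrib)
    then have "\<bar>exp x - poly p x\<bar> = exp s * \<bar>exp (2 * c * y) - poly q y\<bar>"
      by (simp add: x exp_add abs_mult flip: right_diff_distrib)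
    also have "\<dots> \<le> exp s * (2 * exp (c * (r + 1 / r)) / r ^ m + e / exp s)"
      by (intro mult_left_mono approx y) simp
    also have "\<dots> = 2 * exp (s + c * (r + 1 / r)) / r ^ m + e"
      by (simp add: exp_add distrib_left)
    also have "s = b - (b - a) / 2"
      by (simp add: s_def field_simps)
    finally show ?thesis
      by (simp add: c_def)
  qed
  ultimately show ?thesis by blast
qed

section \<open>The two choices of the Chernoff parameter \<open>r\<close>\<close>

text \<open>With \<open>x = 2k/D\<close>, the exponent \<open>D/4 (r + 1/r) - k ln r\<close> is
  smallest at \<open>r = x + sqrt (1 + x^2)\<close>, and \<open>1 + x\<close> is the first-order
  approximation of this for small \<open>x\<close>. Comparing exponents amounts to
  \<open>k * f x <= 0\<close>, and \<open>f\<close>, being convex, lies below its chord on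
  \<open>[0, 1]\<close>.\<close>

lemma chernoff_bound_small:
  fixes D k b :: real and n :: nat
  assumes "k = real n" "n > 0" "k \<le> D / 2" "r = 1 + 2 * k / D"
  shows "2 * exp (b - D / 2 + D / 4 * (r + 1 / r)) / r ^ n
           \<le> 2 * (D / k) * exp (b - 4 * k\<^sup>2 / (5 * D))"
proof -
  define x where "x = 2 * k / D"
  have k: "k > 0" and D: "D > 0" using assms by auto
  have x: "0 < x" "x \<le> 1" using k D assms by (auto simp: x_def field_simps)
  have r: "r = 1 + x" "r > 0" using x assms(4) by (simp_all add: x_def[symmetric])
  define f where "f y = y / (2 * (1 + y)) - ln (1 + y) + 2 * y / 5" for y :: real
  have f': "(f has_real_derivative 1 / (2 * (1 + y)\<^sup>2) - 1 / (1 + y) + 2 / 5) (at y)" if "y \<ge> 0" for y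
  proof -
    have "(f has_real_derivative
        (1 * (2 * (1 + y)) - y * 2) / ((2 * (1 + y)) * (2 * (1 + y))) - 1 / (1 + y) + 2 / 5) (at y)"
      unfolding f_def using that by (auto intro!: derivative_eq_intros)
    moreover have "(1 * (2 * (1 + y)) - y * 2) / ((2 * (1 + y)) * (2 * (1 + y))) = 1 / (2 * (1 + y)\<^sup>2)"
    proof -
      have "1 * (2 * (1 + y)) - y * 2 = 2" by simp
      moreover have "2 / ((2 * z) * (2 * z)) = 1 / (2 * z\<^sup>2)" for z :: real
        by (cases "z = 0") (auto simp: field_simps power2_eq_square)
      ultimately show ?thesis by metis
    qed
    ultimately show ?thesis by metis
  qed
  have "convex_on {0..1} f"
  proof (rule f''_ge0_imp_convex)
    fix y :: real assume y: "y \<in> {0..1}"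
    then show "(f has_real_derivative 1 / (2 * (1 + y)\<^sup>2) - 1 / (1 + y) + 2 / 5) (at y)"
      using f' by auto
    have "((\<lambda>y. 1 / (2 * (1 + y)\<^sup>2) - 1 / (1 + y) + 2 / 5) has_real_derivative
        - (2 * (2 * (1 + y))) / ((2 * (1 + y)\<^sup>2) * (2 * (1 + y)\<^sup>2)) + 1 / ((1 + y) * (1 + y))) (at y)"
      using y by (auto intro!: derivative_eq_intros)
    moreover have "- (2 * (2 * (1 + y))) / ((2 * (1 + y)\<^sup>2) * (2 * (1 + y)\<^sup>2)) + 1 / ((1 + y) * (1 + y))
        = y / (1 + y) ^ 3"
    proof -
      define z where "z = 1 + y"
      have "z \<noteq> 0" "y = z - 1" using y by (auto simp: z_def)
      then show ?thesis
        unfolding z_def[symmetric] by (simp add: field_simps power2_eq_square power3_eq_cube)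
    qed
    ultimately show "((\<lambda>y. 1 / (2 * (1 + y)\<^sup>2) - 1 / (1 + y) + 2 / 5) has_real_derivative
        y / (1 + y) ^ 3) (at y)"
      by simp
    show "0 \<le> y / (1 + y) ^ 3" using y by simp
  qed simp
  then have "f ((1 - x) *\<^sub>R 0 + x *\<^sub>R 1) \<le> (1 - x) * f 0 + x * f 1"
    using x by (intro convex_onD) auto
  \<comment> \<open>Here \<open>f 1 = 13/20 - ln 2\<close>, and \<open>ln 2 >= 2/3\<close>. The
    constant 4/5 of the exponent enters \<open>f\<close> as 2/5.\<close>
  moreover have "f 0 = 0" "f 1 \<le> 0"
    using ln2_ge_two_thirds by (auto simp: f_def)
  ultimately have "f x \<le> 0"
    using x mult_nonneg_nonpos[of x "f 1"] by simp
  then have "k * f x \<le> 0"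
    using k by (simp add: mult_nonneg_nonpos)
  moreover have "k * f x = D / 4 * (r + 1 / r) - D / 2 - k * ln r + 4 * k\<^sup>2 / (5 * D)"
  proof -
    have kx: "k = D * x / 2" using D by (simp add: x_def)
    have "k * (x / (2 * (1 + x))) = D / 4 * (r + 1 / r) - D / 2"
      unfolding r kx using x by (simp add: divide_simps) algebra
    moreover have "k * (2 * x / 5) = 4 * k\<^sup>2 / (5 * D)"
      using D by (simp add: x_def power2_eq_square)
    ultimately show ?thesis
      unfolding f_def r by (simp add: algebra_simps)
  qed
  ultimately have le: "b - D / 2 + D / 4 * (r + 1 / r) - k * ln r \<le> b - 4 * k\<^sup>2 / (5 * D)"
    by linarith
  have "r ^ n = exp (k * ln r)"
    using r assms by (simp add: exp_of_nat_mult)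
  then have "2 * exp (b - D / 2 + D / 4 * (r + 1 / r)) / r ^ n
      = 2 * exp (b - D / 2 + D / 4 * (r + 1 / r) - k * ln r)"
    by (simp add: exp_diff)
  also have "\<dots> \<le> 2 * exp (b - 4 * k\<^sup>2 / (5 * D))"
    using le by simp
  \<comment> \<open>The prefactor \<open>D / k\<close> is at least 2.\<close>
  also have "\<dots> \<le> 2 * (D / k) * exp (b - 4 * k\<^sup>2 / (5 * D))"
    using k assms by (simp add: field_simps)
  finally show ?thesis .
qed

text \<open>For large \<open>2k/D\<close> the optimal \<open>r\<close> is close to
  \<open>4k/D\<close>. With \<open>x = D/(2k)\<close>, now below 1, comparing exponents amounts to
  \<open>k * f x <= 0\<close>, and \<open>f\<close> decreases on \<open>[0, 1]\<close> from
  \<open>f 0 = 0\<close>.\<close>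

lemma chernoff_bound_large:
  fixes D k b :: real and n :: nat
  assumes "k = real n" "D > 0" "k > D / 2" "r = 4 * k / D"
  shows "2 * exp (b - D / 2 + D / 4 * (r + 1 / r)) / r ^ n
           \<le> 8 * (exp b * k / D) * (exp 1 * D / (4 * k + 2 * D)) ^ n"
proof -
  define x where "x = D / (2 * k)"
  have k: "k > 0" using assms by auto
  have x: "0 < x" "x < 1" using k assms by (auto simp: x_def field_simps)
  have rx: "r = 2 / x" using assms by (simp add: x_def field_simps)
  define f where "f y = y\<^sup>2 / 4 - y + ln (1 + y)" for y :: real
  have "f x \<le> f 0"
  proof (rule DERIV_nonpos_imp_nonincreasing[where f = f and a = 0 and b = x])
    fix y assume y: "0 \<le> y" "y \<le> x"
    have "y / 2 - 1 + 1 / (1 + y) = - (y * (1 - y) / (2 * (1 + y)))"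
      using y by (simp add: divide_simps) algebra
    moreover have "(f has_real_derivative y / 2 - 1 + 1 / (1 + y)) (at y)"
      unfolding f_def using y by (auto intro!: derivative_eq_intros)
    ultimately show "\<exists>d. (f has_real_derivative d) (at y) \<and> d \<le> 0"
      using y x by (intro exI[of _ "y / 2 - 1 + 1 / (1 + y)"]) auto
  qed (use x in auto)
  then have "k * f x \<le> 0"
    using k by (simp add: f_def mult_nonneg_nonpos)
  moreover have "k * f x = D / 4 * (r + 1 / r) - D / 2 - k + k * ln (1 + x)"
  proof -
    have Dx: "D = 2 * k * x" using k by (simp add: x_def)
    show ?thesis
      unfolding f_def rx Dx using x by (simp add: field_simps power2_eq_square)
  qed
  ultimately have le: "b - D / 2 + D / 4 * (r + 1 / r) \<le> b + k - k * ln (1 + x)"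
    by linarith
  have r0: "r > 0" using rx x by simp
  have "exp (b - D / 2 + D / 4 * (r + 1 / r)) / r ^ n \<le> exp (b + k - k * ln (1 + x)) / r ^ n"
    using le r0 by (intro divide_right_mono) auto
  also have "\<dots> = exp b * (exp 1 / ((1 + x) * r)) ^ n"
  proof -
    have "exp (k * ln (1 + x)) = (1 + x) ^ n" "exp k = exp 1 ^ n"
      using x assms exp_of_nat_mult[of n "1::real"] by (auto simp: exp_of_nat_mult)
    then show ?thesis
      by (simp add: exp_add exp_diff power_divide power_mult_distrib)
  qed
  also have "(1 + x) * r = (4 * k + 2 * D) / D"
    using k assms by (simp add: x_def field_simps)
  finally have "2 * exp (b - D / 2 + D / 4 * (r + 1 / r)) / r ^ n
      \<le> 2 * (exp b * (exp 1 * D / (4 * k + 2 * D)) ^ n)"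
    by simp
  \<comment> \<open>The inserted factor \<open>4 * k / D\<close> exceeds 2.\<close>
  also have "\<dots> \<le> 4 * k / D * (2 * (exp b * (exp 1 * D / (4 * k + 2 * D)) ^ n))"
    using assms k mult_right_mono[of 1 "4 * k / D" "2 * (exp b * (exp 1 * D / (4 * k + 2 * D)) ^ n)"]
    by simp
  finally show ?thesis
    by (simp add: mult_ac)
qed

section \<open>The Frechet derivative of the matrix exponential\<close>

lemma bounded_bilinear_matrix_mult:
  "bounded_bilinear ((**) :: real^'n^'m \<Rightarrow> real^'k^'n \<Rightarrow> real^'k^'m)"
  unfolding bilinear_conv_bounded_bilinear[symmetric] bilinear_def
  by (auto intro!: linearI simp: vec_eq_iff matrix_matrix_mult_def sum.distrib sum_distrib_left algebra_simps)

definition matrix_pow_deriv :: "nat \<Rightarrow> real^'n^'n \<Rightarrow> real^'n^'n \<Rightarrow> real^'n^'n" where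
  "matrix_pow_deriv n A H = (\<Sum>p<n. matrix_pow A p ** H ** matrix_pow A (n - Suc p))"

lemma has_derivative_matrix_pow:
  "((\<lambda>A. matrix_pow A n) has_derivative matrix_pow_deriv n A) (at A within S)"
proof (induction n)
  case 0
  then show ?case
    by (simp add: matrix_pow_deriv_def)
next
  case (Suc n)
  have "((\<lambda>A. A ** matrix_pow A n) has_derivative
      (\<lambda>H. A ** matrix_pow_deriv n A H + H ** matrix_pow A n)) (at A within S)"
    by (rule bounded_bilinear.FDERIV[OF bounded_bilinear_matrix_mult has_derivative_ident Suc])
  also have "(\<lambda>H. A ** matrix_pow_deriv n A H + H ** matrix_pow A n) = matrix_pow_deriv (Suc n) A"
    by (simp add: fun_eq_iff matrix_pow_deriv_def sum.lessThan_Suc_shift matrix_mul_assoc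
        bounded_bilinear.sum_right[OF bounded_bilinear_matrix_mult] del: sum.lessThan_Suc)
  finally show ?case
    by simp
qed

text \<open>Uniformity over a ball makes these bounds majorants for the exponential series and its
  termwise derivative.\<close>

lemma matrix_pow_bounds:
  fixes R :: real
  obtains C B
  where "\<And>(A :: real^'n^'n) n. norm A \<le> R \<Longrightarrow> norm (matrix_pow A n) \<le> C * B ^ n"
    and "\<And>(A :: real^'n^'n) n H. norm A \<le> R \<Longrightarrow>
      norm ((1 / fact n) *\<^sub>R matrix_pow_deriv n A H) \<le> C * (B ^ n / fact n) * norm H"
proof -
  obtain K where K: "K > 0"
    "\<And>(A::real^'n^'n) (B::real^'n^'n). norm (A ** B) \<le> norm A * norm B * K"
    using bounded_bilinear.pos_bounded[OF bounded_bilinear_matrix_mult] by metis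
  \<comment> \<open>At least 1, so that raising an exponent only enlarges a power of
    \<open>B\<close>.\<close>
  define B where "B = max 1 (K * R)"
  define c where "c = norm (mat 1 :: real^'n^'n)"
  have B: "B \<ge> 1" "K * R \<le> B" by (auto simp: B_def)
  have c: "c \<ge> 0" by (simp add: c_def)
  have pow: "norm (matrix_pow A n) \<le> c * B ^ n" if "norm A \<le> R" for A :: "real^'n^'n" and n
  proof (induction n)
    case (Suc n)
    have "norm (matrix_pow A (Suc n)) \<le> norm A * norm (matrix_pow A n) * K"
      using K(2) by simp
    also have "\<dots> = (K * norm A) * norm (matrix_pow A n)"
      by simp
    also have "\<dots> \<le> B * (c * B ^ n)"
    proof (rule mult_mono[OF _ Suc.IH])
      show "K * norm A \<le> B"
        using that K(1) B(2) by (meson mult_left_mono less_imp_le order_trans)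
    qed (use B in auto)
    finally show ?case
      by (simp add: mult_ac)
  qed (simp add: c_def)
  have deriv: "norm ((1 / fact n) *\<^sub>R matrix_pow_deriv n A H) \<le> (c * K) * (c * K) * ((2 * B) ^ n / fact n) * norm H"
    if "norm A \<le> R" for A H :: "real^'n^'n" and n
  proof -
    have "norm (matrix_pow A p ** H ** matrix_pow A (n - Suc p)) \<le> (c * K) * (c * K) * B ^ n * norm H"
      if "p < n" for p
    proof -
      have "norm (matrix_pow A p ** H ** matrix_pow A (n - Suc p))
          \<le> (norm (matrix_pow A p) * norm H * K) * norm (matrix_pow A (n - Suc p)) * K"
        using K by (meson less_imp_le mult_right_mono norm_ge_zero order_trans)
      also have "\<dots> \<le> ((c * B ^ p) * norm H * K) * (c * B ^ (n - Suc p)) * K"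
        using pow[OF \<open>norm A \<le> R\<close>] K(1) B(1) c by (intro mult_mono) auto
      also have "\<dots> = (c * K) * (c * K) * B ^ (p + (n - Suc p)) * norm H"
        by (simp add: power_add mult_ac)
      also have "\<dots> \<le> (c * K) * (c * K) * B ^ n * norm H"
        using K(1) B(1) c that by (intro mult_right_mono mult_left_mono power_increasing) auto
      finally show ?thesis .
    qed
    then have "norm (matrix_pow_deriv n A H) \<le> (\<Sum>p<n. (c * K) * (c * K) * B ^ n * norm H)"
      unfolding matrix_pow_deriv_def by (intro order_trans[OF norm_sum] sum_mono) auto
    also have "\<dots> = real n * ((c * K) * (c * K) * B ^ n * norm H)"
      by simp
    \<comment> \<open>The number \<open>n\<close> of summands is absorbed into \<open>2 ^ n\<close>;
      hence the base \<open>2 * B\<close>.\<close>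
    also have "\<dots> \<le> 2 ^ n * ((c * K) * (c * K) * B ^ n * norm H)"
      using K(1) B(1) c of_nat_less_two_power[of n, where 'a = real] by (intro mult_right_mono) auto
    finally show ?thesis
      by (simp add: divide_right_mono power_mult_distrib mult_ac)
  qed
  define C where "C = max c ((c * K) * (c * K))"
  show ?thesis
  proof (rule that[of C "2 * B"])
    fix A H :: "real^'n^'n" and n
    assume A: "norm A \<le> R"
    have "c * B ^ n \<le> C * (2 * B) ^ n"
      using B(1) c by (intro mult_mono power_mono) (auto simp: C_def)
    with pow[OF A] show "norm (matrix_pow A n) \<le> C * (2 * B) ^ n"
      by (rule order_trans)
    have "(c * K) * (c * K) * ((2 * B) ^ n / fact n) * norm H \<le> C * ((2 * B) ^ n / fact n) * norm H"
      using B(1) by (intro mult_right_mono) (auto simp: C_def)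
    with deriv[OF A] show "norm ((1 / fact n) *\<^sub>R matrix_pow_deriv n A H) \<le> C * ((2 * B) ^ n / fact n) * norm H"
      by (rule order_trans)
  qed
qed

lemma summable_pow_div_fact: "summable (\<lambda>n. C * (x ^ n / fact n))" for x C :: real
  by (intro summable_mult sums_summable[OF sums_real_exp])

lemma summable_matrix_exp:
  fixes A :: "real^'n^'n"
  shows "summable (\<lambda>n. (1 / fact n) *\<^sub>R matrix_pow A n)"
proof -
  obtain C B where "\<And>(X :: real^'n^'n) n. norm X \<le> norm A \<Longrightarrow> norm (matrix_pow X n) \<le> C * B ^ n"
    by (rule matrix_pow_bounds[where R = "norm A"]) (rule that)
  from this[of A] have "norm ((1 / fact n) *\<^sub>R matrix_pow A n) \<le> C * (B ^ n / fact n)" for n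
    by (simp add: divide_right_mono)
  then show ?thesis
    by (rule summable_comparison_test'[OF summable_pow_div_fact])
qed

text \<open>Termwise differentiation: on a ball around \<open>A\<close> the differentiated series
  converges uniformly by the majorant \<open>C * (B ^ n / fact n)\<close>. Uniqueness of the
  derivative identifies its sum with \<open>L_exp\<close>.\<close>

lemma L_exp_sums:
  fixes A H :: "real^'n^'n"
  shows "(\<lambda>n. (1 / fact n) *\<^sub>R matrix_pow_deriv n A H) sums L_exp A H"
proof -
  define S where "S = ball (0 :: real^'n^'n) (norm A + 1)"
  obtain C B where CB: "\<And>(X :: real^'n^'n) n H. norm X \<le> norm A + 1 \<Longrightarrow>
      norm ((1 / fact n) *\<^sub>R matrix_pow_deriv n X H) \<le> C * (B ^ n / fact n) * norm H"
    by (rule matrix_pow_bounds[where R = "norm A + 1"]) (rule that)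
  have bound: "norm ((1 / fact n) *\<^sub>R matrix_pow_deriv n X H) \<le> C * (B ^ n / fact n) * norm H"
    if "X \<in> S" for X H :: "real^'n^'n" and n
    using that by (intro CB) (simp add: S_def)
  have sm: "summable (\<lambda>n. C * (B ^ n / fact n) * z)" for z
    by (rule summable_mult2[OF summable_pow_div_fact])
  have sm': "summable (\<lambda>n. (1 / fact n) *\<^sub>R matrix_pow_deriv n X H)" if "X \<in> S" for X H
    by (rule summable_comparison_test'[OF sm bound[OF that]])
  define g where "g X H = (\<Sum>n. (1 / fact n) *\<^sub>R matrix_pow_deriv n X H)" for X H :: "real^'n^'n"
  have AS: "A \<in> S" by (simp add: S_def)
  have "\<exists>G. \<forall>X\<in>S. (\<lambda>n. (1 / fact n) *\<^sub>R matrix_pow X n) sums G X \<and> (G has_derivative g X) (at X within S)"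
  proof (rule has_derivative_series[OF _ _ _ AS summable_sums[OF summable_matrix_exp]])
    show "convex S" by (simp add: S_def)
    show "((\<lambda>X. (1 / fact n) *\<^sub>R matrix_pow X n) has_derivative
        (\<lambda>H. (1 / fact n) *\<^sub>R matrix_pow_deriv n X H)) (at X within S)" for n X
      by (rule has_derivative_scaleR_right[OF has_derivative_matrix_pow])
    fix e :: real assume "e > 0"
    have "(\<lambda>N. \<Sum>n. C * (B ^ (n + N) / fact (n + N))) \<longlonglongrightarrow> 0"
      by (rule suminf_exist_split2[OF summable_pow_div_fact])
    then have "\<forall>\<^sub>F N in sequentially. (\<Sum>n. C * (B ^ (n + N) / fact (n + N))) < e"
      using \<open>e > 0\<close> by (rule order_tendstoD)
    then show "\<forall>\<^sub>F N in sequentially. \<forall>X\<in>S. \<forall>H.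
        norm ((\<Sum>n<N. (1 / fact n) *\<^sub>R matrix_pow_deriv n X H) - g X H) \<le> e * norm H"
    proof (eventually_elim, intro ballI allI)
      fix N X and H :: "real^'n^'n"
      assume N: "(\<Sum>n. C * (B ^ (n + N) / fact (n + N))) < e" and X: "X \<in> S"
      have "norm ((\<Sum>n<N. (1 / fact n) *\<^sub>R matrix_pow_deriv n X H) - g X H)
          = norm (\<Sum>n. (1 / fact (n + N)) *\<^sub>R matrix_pow_deriv (n + N) X H)"
        unfolding g_def suminf_minus_initial_segment[OF sm'[OF X], of N] by (rule norm_minus_commute)
      also have "\<dots> \<le> (\<Sum>n. C * (B ^ (n + N) / fact (n + N)) * norm H)"
        by (rule norm_suminf_le[OF bound[OF X]])
          (rule summable_mult2[OF summable_ignore_initial_segment[OF summable_pow_div_fact]])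
      also have "\<dots> = (\<Sum>n. C * (B ^ (n + N) / fact (n + N))) * norm H"
        by (rule suminf_mult2[OF summable_ignore_initial_segment[OF summable_pow_div_fact], symmetric])
      also have "\<dots> \<le> e * norm H"
        using N by (intro mult_right_mono) auto
      finally show "norm ((\<Sum>n<N. (1 / fact n) *\<^sub>R matrix_pow_deriv n X H) - g X H) \<le> e * norm H" .
    qed
  qed
  then obtain G where G: "\<forall>X\<in>S. (\<lambda>n. (1 / fact n) *\<^sub>R matrix_pow X n) sums G X \<and>
      (G has_derivative g X) (at X within S)" ..
  have "open S" by (simp add: S_def)
  have "(G has_derivative g A) (at A)"
    using conjunct2[OF bspec[OF G AS]] unfolding at_within_open[OF AS \<open>open S\<close>] .
  moreover have "G X = matrix_exp X" if "X \<in> S" for X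
    using sums_unique[OF conjunct1[OF bspec[OF G that]]] unfolding matrix_exp_def .
  ultimately have "(matrix_exp has_derivative g A) (at A)"
    by (rule has_derivative_transform_within_open[OF _ \<open>open S\<close> AS])
  then have "L_exp A = g A"
    unfolding L_exp_def by (rule frechet_derivative_at[symmetric])
  then show ?thesis
    using summable_sums[OF sm'[OF AS], of H] by (simp only: g_def)
qed

lemma matrix_unit_matrix_mult:
  "(X ** unit_matrix i j ** Y) $ u $ v = X $ u $ i * Y $ j $ v"
proof -
  have "unit_matrix i j $ a $ b = (if a = i then if b = j then 1 else 0 else 0)" for a b
    by (auto simp: unit_matrix_def matrix_matrix_mult_def columnvector_def rowvector_def axis_def)
  then have "(X ** unit_matrix i j) $ u $ k = (if k = j then X $ u $ i else 0)" for k
    by (simp add: matrix_matrix_mult_def mult_delta_right)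
  then show ?thesis
    by (simp add: matrix_matrix_mult_def[of "X ** unit_matrix i j" Y] mult_delta_left)
qed

lemma L_exp_unit_matrix_sums:
  fixes A :: "real^'n^'n"
  shows "(\<lambda>n. 1 / fact n * (\<Sum>p<n. matrix_pow A p $ u $ i * matrix_pow A (n - Suc p) $ j $ v))
     sums (L_exp A (unit_matrix i j) $ u $ v)"
proof -
  have "bounded_linear (\<lambda>M :: real^'n^'n. M $ u $ v)"
    by (rule bounded_linear_compose[OF bounded_linear_vec_nth bounded_linear_vec_nth])
  from bounded_linear.sums[OF this L_exp_sums[of A "unit_matrix i j"]]
  show ?thesis
    by (simp add: matrix_pow_deriv_def matrix_unit_matrix_mult)
qed

section \<open>Spectral decomposition of symmetric matrices\<close>

lemma inner_symmetric_matrix: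
  fixes A :: "real^'n^'n"
  assumes "transpose A = A"
  shows "(A *v x) \<bullet> y = x \<bullet> (A *v y)"
  using dot_lmul_matrix[of x A y] assms by (metis transpose_matrix_vector)

text \<open>A maximizer of the Rayleigh quotient over the unit sphere of the subspace is an eigenvector.\<close>
lemma symmetric_matrix_eigenvector_in_subspace:
  fixes A :: "real^'n^'n"
  assumes sym: "transpose A = A"
    and W: "subspace W" "w \<in> W" "w \<noteq> 0"
    and inv: "\<And>x. x \<in> W \<Longrightarrow> A *v x \<in> W"
  obtains x l where "x \<in> W" "norm x = 1" "A *v x = l *\<^sub>R x"
proof -
  define S where "S = W \<inter> sphere 0 1"
  have "compact S"
    unfolding S_def by (intro closed_Int_compact closed_subspace W compact_sphere)
  moreover have "(1 / norm w) *\<^sub>R w \<in> S"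
    using W by (simp add: S_def subspace_scale)
  then have "S \<noteq> {}" by blast
  moreover have "continuous_on S (\<lambda>x. x \<bullet> (A *v x))"
    by (intro continuous_intros linear_continuous_on) simp
  ultimately obtain x where x: "x \<in> S" and max: "\<forall>y\<in>S. y \<bullet> (A *v y) \<le> x \<bullet> (A *v x)"
    using continuous_attains_sup by blast
  define l where "l = x \<bullet> (A *v x)"
  have xW: "x \<in> W" and xx: "x \<bullet> x = 1" "norm x = 1"
    using x by (auto simp: S_def dot_square_norm)
  \<comment> \<open>By maximality \<open>q\<close> is nonnegative on \<open>W\<close>, and it
    vanishes at \<open>x\<close>, so \<open>x\<close> minimises it there. The vector
    \<open>z\<close> below is half the gradient of \<open>q\<close> at \<open>x\<close>.\<close>
  define q where "q y = l * (y \<bullet> y) - y \<bullet> (A *v y)" for y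
  have q: "q y \<ge> 0" if "y \<in> W" for y
  proof (cases "y = 0")
    case False
    define c where "c = 1 / norm y"
    have "c *\<^sub>R y \<in> S"
      using that False W(1) by (simp add: S_def subspace_scale c_def)
    then have "c *\<^sub>R y \<bullet> (A *v (c *\<^sub>R y)) \<le> l"
      using max unfolding l_def by blast
    then have "c\<^sup>2 * (y \<bullet> (A *v y)) \<le> l"
      by (simp add: matrix_vector_mult_scaleR power2_eq_square)
    then have "(y \<bullet> (A *v y)) / (y \<bullet> y) \<le> l"
      by (simp add: c_def power_divide dot_square_norm)
    then show ?thesis
      using False by (simp add: q_def pos_divide_le_eq)
  qed (simp add: q_def)
  define z where "z = l *\<^sub>R x - A *v x"
  have zW: "z \<in> W"
    unfolding z_def by (intro subspace_diff subspace_scale W inv xW)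
  have expand: "q (x + t *\<^sub>R z) = 2 * t * (z \<bullet> z) + t\<^sup>2 * q z" for t
  proof -
    have "z \<bullet> (A *v x) = x \<bullet> (A *v z)"
      using inner_symmetric_matrix[OF sym, of z x] by (simp add: inner_commute)
    moreover have "l * (x \<bullet> z) - z \<bullet> (A *v x) = z \<bullet> z"
      unfolding z_def by (simp add: algebra_simps inner_commute)
    ultimately have eq: "z \<bullet> z = l * (x \<bullet> z) - x \<bullet> (A *v z)" by simp
    have "q (x + t *\<^sub>R z) = 2 * t * (l * (x \<bullet> z) - x \<bullet> (A *v z)) + t\<^sup>2 * q z"
      using \<open>z \<bullet> (A *v x) = x \<bullet> (A *v z)\<close> unfolding q_def
      by (simp add: xx l_def[symmetric] matrix_vector_right_distrib matrix_vector_mult_scaleR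
          inner_add_left inner_add_right inner_commute[of z x] power2_eq_square algebra_simps)
    then show ?thesis by (simp only: eq)
  qed
  \<comment> \<open>A descent step: for this \<open>t\<close> the linear term outweighs the
    quadratic one unless \<open>z = 0\<close>. Adding 1 keeps the denominator positive.\<close>
  define t where "t = - (z \<bullet> z) / (q z + 1)"
  have qz: "q z \<ge> 0" by (rule q[OF zW])
  have "0 \<le> q (x + t *\<^sub>R z)"
    by (intro q subspace_add subspace_scale W xW zW)
  also have "\<dots> = - ((z \<bullet> z)\<^sup>2 * (q z + 2) / (q z + 1)\<^sup>2)"
  proof -
    define a where "a = q z + 1"
    have a: "a \<noteq> 0" and qa: "q z = a - 1" using qz by (auto simp: a_def)
    show ?thesis
      unfolding expand t_def qa using a by (simp add: field_simps power2_eq_square)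
  qed
  finally have "(z \<bullet> z)\<^sup>2 * (q z + 2) / (q z + 1)\<^sup>2 \<le> 0" by simp
  then have "z = 0"
    using qz by (simp add: divide_le_0_iff mult_le_0_iff)
  then have "A *v x = l *\<^sub>R x" by (simp add: z_def)
  then show ?thesis using that xW xx(2) by blast
qed

text \<open>Orthonormal sets of eigenvectors have size at most the dimension, so a largest one
  exists. It spans: by symmetry its orthogonal complement is invariant under \<open>A\<close>, and a
  unit eigenvector there would enlarge it.\<close>

lemma symmetric_matrix_orthonormal_eigenbasis:
  fixes A :: "real^'n^'n"
  assumes sym: "transpose A = A"
  obtains B :: "(real^'n) set" and l where "finite B" "pairwise orthogonal B" "span B = UNIV"
    "\<And>b. b \<in> B \<Longrightarrow> norm b = 1" "\<And>b. b \<in> B \<Longrightarrow> A *v b = l b *\<^sub>R b"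
proof -
  define P where "P B \<longleftrightarrow> pairwise orthogonal B \<and> (\<forall>b\<in>B. norm b = 1 \<and> (\<exists>l. A *v b = l *\<^sub>R b))"
    for B :: "(real^'n) set"
  have fin: "finite B \<and> card B \<le> DIM(real^'n)" if "P B" for B
  proof -
    have "pairwise orthogonal B" "0 \<notin> B" using that by (auto simp: P_def)
    then show ?thesis by (intro independent_bound pairwise_orthogonal_independent)
  qed
  have "P {}" by (simp add: P_def)
  moreover have "\<forall>B. P B \<longrightarrow> card B < Suc (DIM(real^'n))"
    using fin by (simp add: le_imp_less_Suc)
  ultimately obtain B where B: "P B" and max: "\<And>C. P C \<Longrightarrow> card C \<le> card B"
    using ex_has_greatest_nat[of P "{}" card] by blast
  have "span B = UNIV"
  proof (rule ccontr)
    assume "span B \<noteq> UNIV"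
    then obtain w where w: "w \<noteq> 0" "\<forall>x\<in>span B. w \<bullet> x = 0"
      using span_not_UNIV_orthogonal by blast
    define W where "W = {x. \<forall>b\<in>B. x \<bullet> b = 0}"
    have "subspace W"
      by (simp add: W_def subspace_def inner_add_left)
    moreover have "w \<in> W"
      using w by (simp add: W_def span_base)
    moreover have "A *v x \<in> W" if "x \<in> W" for x
    proof -
      have "(A *v x) \<bullet> b = 0" if "b \<in> B" for b
      proof -
        obtain l where "A *v b = l *\<^sub>R b" using B \<open>b \<in> B\<close> by (auto simp: P_def)
        then show ?thesis
          using \<open>x \<in> W\<close> \<open>b \<in> B\<close> inner_symmetric_matrix[OF sym, of x b] by (simp add: W_def)
      qed
      then show ?thesis by (simp add: W_def)
    qed
    ultimately obtain x l where x: "x \<in> W" "norm x = 1" "A *v x = l *\<^sub>R x"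
      using symmetric_matrix_eigenvector_in_subspace[OF sym _ _ w(1)] by metis
    have "x \<notin> B"
    proof
      assume "x \<in> B"
      then have "x \<bullet> x = 0" using x(1) by (simp add: W_def)
      then show False using x(2) by simp
    qed
    have "P (insert x B)"
      using B x unfolding P_def W_def
      by (auto simp: pairwise_insert orthogonal_def inner_commute)
    then have "card (insert x B) \<le> card B" by (rule max)
    then show False using fin[OF B] \<open>x \<notin> B\<close> by simp
  qed
  moreover obtain l where "\<And>b. b \<in> B \<Longrightarrow> A *v b = l b *\<^sub>R b"
    using B unfolding P_def by metis
  ultimately show ?thesis
    using that[of B l] fin[OF B] B by (auto simp: P_def)
qed

lemma matrix_pow_eigenvector:
  fixes A :: "real^'n^'n"
  assumes "A *v b = l *\<^sub>R b"
  shows "matrix_pow A p *v b = l ^ p *\<^sub>R b"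
  by (induction p)
    (simp_all add: assms matrix_vector_mul_assoc[symmetric] matrix_vector_mult_scaleR mult.commute)

text \<open>Unit vectors are expanded in an orthonormal eigenbasis. Finiteness and nonemptiness of
  \<open>B\<close> make \<open>lambda_min\<close> and \<open>lambda_max\<close> actual
  eigenvalues.\<close>

lemma symmetric_matrix_spectral_decomposition:
  fixes A :: "real^'n^'n"
  assumes sym: "transpose A = A"
  obtains B :: "(real^'n) set" and l
  where "finite B" "B \<noteq> {}" "eigenvalues A = l ` B"
    "\<And>p u i. matrix_pow A p $ u $ i = (\<Sum>b\<in>B. l b ^ p * (b $ u * b $ i))"
    "\<And>u i. (\<Sum>b\<in>B. \<bar>b $ u * b $ i\<bar>) \<le> 1"
proof -
  obtain B :: "(real^'n) set" and l where B: "finite B" "pairwise orthogonal B" "span B = UNIV"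
    "\<And>b. b \<in> B \<Longrightarrow> norm b = 1" and l: "\<And>b. b \<in> B \<Longrightarrow> A *v b = l b *\<^sub>R b"
    using symmetric_matrix_orthonormal_eigenbasis[OF sym] by metis
  have expand: "(\<Sum>b\<in>B. (b \<bullet> x) *\<^sub>R b) = x" for x
    using B orthonormal_basis_expand[of B x] by (simp add: inner_commute)
  have inner_axis: "b \<bullet> axis i 1 = b $ i" for b :: "real^'n" and i
    by (simp add: inner_axis)
  have eig: "eigenvalues A = l ` B"
  proof
    show "l ` B \<subseteq> eigenvalues A"
    proof
      fix k assume "k \<in> l ` B"
      then obtain b where b: "b \<in> B" "k = l b" by blast
      have "b \<noteq> 0" using B(4)[OF b(1)] by auto
      then show "k \<in> eigenvalues A"
        using l[OF b(1)] b(2) by (auto simp: eigenvalues_def)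
    qed
    show "eigenvalues A \<subseteq> l ` B"
    proof
      fix k assume "k \<in> eigenvalues A"
      then obtain x where x: "x \<noteq> 0" "A *v x = k *\<^sub>R x"
        by (auto simp: eigenvalues_def)
      \<comment> \<open>Some basis vector is not orthogonal to \<open>x\<close>; moving
        \<open>A\<close> across that inner product forces \<open>k = l b\<close>.\<close>
      have "\<not> (\<forall>b\<in>B. b \<bullet> x = 0)"
      proof
        assume "\<forall>b\<in>B. b \<bullet> x = 0"
        then have "(\<Sum>b\<in>B. (b \<bullet> x) *\<^sub>R b) = 0" by simp
        then show False using expand[of x] x(1) by simp
      qed
      then obtain b where b: "b \<in> B" "b \<bullet> x \<noteq> 0" by blast
      have "l b * (b \<bullet> x) = k * (b \<bullet> x)"
        using inner_symmetric_matrix[OF sym, of b x] by (simp add: x(2) l[OF b(1)])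
      then show "k \<in> l ` B" using b by auto
    qed
  qed
  have pow: "matrix_pow A p $ u $ i = (\<Sum>b\<in>B. l b ^ p * (b $ u * b $ i))" for p u i
  proof -
    have "matrix_pow A p $ u $ i = (matrix_pow A p *v axis i 1) $ u"
      by (simp add: matrix_vector_mult_basis column_def)
    also have "\<dots> = (matrix_pow A p *v (\<Sum>b\<in>B. (b \<bullet> axis i 1) *\<^sub>R b)) $ u"
      by (simp only: expand)
    also have "\<dots> = (\<Sum>b\<in>B. (b \<bullet> axis i 1) *\<^sub>R (matrix_pow A p *v b)) $ u"
      by (simp add: linear_sum matrix_vector_mult_scaleR)
    also have "\<dots> = (\<Sum>b\<in>B. l b ^ p * (b $ u * b $ i))"
      by (simp add: inner_axis matrix_pow_eigenvector[OF l] mult_ac)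
    finally show ?thesis .
  qed
  \<comment> \<open>Power 0 is the identity matrix; its diagonal gives the unit square sums.\<close>
  have square: "(\<Sum>b\<in>B. (b $ i)\<^sup>2) = 1" for i
    using pow[of 0 i i] by (simp add: mat_def power2_eq_square)
  have "(\<Sum>b\<in>B. \<bar>b $ u * b $ i\<bar>) \<le> 1" for u i
  proof -
    have "\<bar>x * y\<bar> \<le> (x\<^sup>2 + y\<^sup>2) / 2" for x y :: real
      using sum_squares_bound[of "\<bar>x\<bar>" "\<bar>y\<bar>"] by (simp add: abs_mult)
    then have "(\<Sum>b\<in>B. \<bar>b $ u * b $ i\<bar>) \<le> (\<Sum>b\<in>B. ((b $ u)\<^sup>2 + (b $ i)\<^sup>2) / 2)"
      by (intro sum_mono)
    also have "\<dots> = 1"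
      by (simp add: sum_divide_distrib[symmetric] sum.distrib square)
    finally show ?thesis .
  qed
  moreover have "B \<noteq> {}"
    using square[of undefined] by auto
  ultimately show ?thesis
    using that[of B l] B(1) eig pow by blast
qed

section \<open>Decay bounds\<close>

text \<open>The argument \<open>f'\<close> stands for the derivative of \<open>f\<close> and
  supplies the confluent value at coinciding points.\<close>

definition divided_difference :: "(real \<Rightarrow> real) \<Rightarrow> (real \<Rightarrow> real) \<Rightarrow> real \<Rightarrow> real \<Rightarrow> real" where
  "divided_difference f f' x y = (if x = y then f' x else (f x - f y) / (x - y))"

lemma divided_difference_power:
  "divided_difference (\<lambda>x. x ^ n) (\<lambda>x. real n * x ^ (n - 1)) x y = (\<Sum>p<n. x ^ p * y ^ (n - Suc p))"
proof (cases "x = y")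
  case True
  then show ?thesis
    by (simp add: divided_difference_def flip: power_add)
next
  case False
  then show ?thesis
    by (simp add: divided_difference_def power_diff_sumr2 mult.commute)
qed

lemma divided_difference_exp_sums:
  "(\<lambda>n. 1 / fact n * (\<Sum>p<n. x ^ p * y ^ (n - Suc p))) sums divided_difference exp exp x y"
proof (cases "x = y")
  case True
  note sums_real_exp[of x]
  moreover have "real (Suc n) * x ^ n / fact (Suc n) = x ^ n / fact n" for n
    by (simp del: of_nat_Suc)
  ultimately have "(\<lambda>n. real (Suc n) * x ^ n / fact (Suc n)) sums exp x" by (simp only:)
  \<comment> \<open>The term at \<open>n = 0\<close> is zero, so the index shift leaves the sum
    unchanged.\<close>
  then have "(\<lambda>n. real n * x ^ (n - 1) / fact n) sums exp x"
    using sums_Suc_iff[of "\<lambda>n. real n * x ^ (n - 1) / fact n" "exp x"] by simp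
  then show ?thesis
    unfolding divided_difference_power[symmetric] using True by (simp add: divided_difference_def)
next
  case False
  show ?thesis
    unfolding divided_difference_power[symmetric]
    using sums_divide[OF sums_diff[OF sums_real_exp[of x] sums_real_exp[of y]], of "x - y"] False
    by (simp add: divided_difference_def diff_divide_distrib mult.commute)
qed

lemma divided_difference_poly:
  "divided_difference (poly P) (poly (pderiv P)) x y
     = (\<Sum>n\<le>degree P. coeff P n * (\<Sum>p<n. x ^ p * y ^ (n - Suc p)))"
proof -
  have "poly (pderiv P) z = (\<Sum>n\<le>degree P. coeff P n * (real n * z ^ (n - 1)))" for z
  proof -
    have "pderiv P = pderiv (\<Sum>n\<le>degree P. monom (coeff P n) n)"
      by (simp add: poly_as_sum_of_monoms)
    then show ?thesis
      by (simp add: higher_pderiv_sum[of 1, simplified] pderiv_monom poly_sum poly_monom mult_ac)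
  qed
  then show ?thesis
    unfolding divided_difference_power[symmetric]
    by (simp add: divided_difference_def poly_altdef sum_divide_distrib right_diff_distrib
        flip: sum_subtractf)
qed

text \<open>The mean value inequality off the diagonal, the bound on \<open>f'\<close> itself on
  it.\<close>

lemma abs_divided_difference_le:
  assumes "\<And>z. z \<in> {a..b} \<Longrightarrow> (f has_real_derivative f' z) (at z)"
    and "\<And>z. z \<in> {a..b} \<Longrightarrow> \<bar>f' z\<bar> \<le> M"
    and "x \<in> {a..b}" "y \<in> {a..b}"
  shows "\<bar>divided_difference f f' x y\<bar> \<le> M"
proof (cases "x = y")
  case True
  then show ?thesis
    using assms by (simp add: divided_difference_def)
next
  case False
  have "norm (f x - f y) \<le> M * norm (x - y)"
  proof (rule field_differentiable_bound[of "{a..b}" f f'])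
    show "(f has_real_derivative f' z) (at z within {a..b})" if "z \<in> {a..b}" for z
      using assms(1)[OF that] by (rule has_field_derivative_at_within)
  qed (use assms in auto)
  then show ?thesis
    using False by (simp add: divided_difference_def pos_divide_le_eq)
qed

text \<open>
  In an orthonormal eigenbasis, the entry of the derivative of a function \<open>f\<close> of \<open>A\<close> is a
  combination of divided differences of \<open>f\<close> at eigenvalues, with coefficients of absolute sum at
  most 1. It vanishes for \<open>f\<close> an antiderivative of \<open>q\<close>, so \<open>exp\<close> may be replaced by its
  difference with this antiderivative, whose divided differences are bounded by \<open>exp - q\<close>.
\<close>
lemma L_exp_unit_matrix_le_approx_error:
  fixes A :: "real^'n^'n"
  assumes sym: "transpose A = A"
    and zero: "\<And>p q. p + q < m \<Longrightarrow> matrix_pow A p $ u $ i * matrix_pow A q $ j $ v = 0"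
    and deg: "degree q < m"
    and err: "\<And>x. x \<in> {lambda_min A..lambda_max A} \<Longrightarrow> \<bar>exp x - poly q x\<bar> \<le> M"
  shows "\<bar>L_exp A (unit_matrix i j) $ u $ v\<bar> \<le> M"
proof -
  obtain B :: "(real^'n) set" and l where B: "finite B" "B \<noteq> {}" and eig: "eigenvalues A = l ` B"
    and pow: "\<And>p u i. matrix_pow A p $ u $ i = (\<Sum>b\<in>B. l b ^ p * (b $ u * b $ i))"
    and le1: "\<And>u i. (\<Sum>b\<in>B. \<bar>b $ u * b $ i\<bar>) \<le> 1"
    by (rule symmetric_matrix_spectral_decomposition[OF sym]) (rule that)
  have l: "l b \<in> {lambda_min A..lambda_max A}" if "b \<in> B" for b
    using that B by (simp add: lambda_min_def lambda_max_def eig)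
  have M: "M \<ge> 0"
    using err l B(2) by (meson abs_ge_zero all_not_in_conv order_trans)
  define c where "c a b = (a $ u * a $ i) * (b $ j * b $ v)" for a b :: "real^'n"
  define S where "S n a b = (\<Sum>p<n. l a ^ p * l b ^ (n - Suc p))" for n a b
  have powers: "(\<Sum>p<n. matrix_pow A p $ u $ i * matrix_pow A (n - Suc p) $ j $ v)
      = (\<Sum>a\<in>B. \<Sum>b\<in>B. c a b * S n a b)" for n
  proof -
    have "(\<Sum>p<n. matrix_pow A p $ u $ i * matrix_pow A (n - Suc p) $ j $ v)
        = (\<Sum>p<n. \<Sum>a\<in>B. \<Sum>b\<in>B. c a b * (l a ^ p * l b ^ (n - Suc p)))"
      unfolding pow sum_product c_def by (simp add: mult_ac)
    also have "\<dots> = (\<Sum>a\<in>B. \<Sum>p<n. \<Sum>b\<in>B. c a b * (l a ^ p * l b ^ (n - Suc p)))"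
      by (rule sum.swap)
    also have "\<dots> = (\<Sum>a\<in>B. \<Sum>b\<in>B. \<Sum>p<n. c a b * (l a ^ p * l b ^ (n - Suc p)))"
      by (intro sum.cong refl sum.swap)
    finally show ?thesis by (simp add: S_def sum_distrib_left)
  qed
  have "(\<lambda>n. \<Sum>a\<in>B. \<Sum>b\<in>B. c a b * (1 / fact n * S n a b))
      sums (\<Sum>a\<in>B. \<Sum>b\<in>B. c a b * divided_difference exp exp (l a) (l b))"
    unfolding S_def by (intro sums_sum sums_mult divided_difference_exp_sums)
  moreover have "(\<lambda>n. \<Sum>a\<in>B. \<Sum>b\<in>B. c a b * (1 / fact n * S n a b))
      sums (L_exp A (unit_matrix i j) $ u $ v)"
    using L_exp_unit_matrix_sums[of A u i j v] unfolding powers by (simp add: sum_divide_distrib)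
  ultimately have L: "L_exp A (unit_matrix i j) $ u $ v
      = (\<Sum>a\<in>B. \<Sum>b\<in>B. c a b * divided_difference exp exp (l a) (l b))"
    by (rule sums_unique2[symmetric])
  obtain P where P: "pderiv P = q" "degree P \<le> Suc (degree q)"
    using ex_poly_antiderivative by blast
  have "(\<Sum>a\<in>B. \<Sum>b\<in>B. c a b * divided_difference (poly P) (poly q) (l a) (l b))
      = (\<Sum>a\<in>B. \<Sum>b\<in>B. \<Sum>n\<le>degree P. coeff P n * (c a b * S n a b))"
    unfolding P(1)[symmetric] divided_difference_poly S_def[symmetric] by (simp add: sum_distrib_left mult_ac)
  also have "\<dots> = (\<Sum>a\<in>B. \<Sum>n\<le>degree P. \<Sum>b\<in>B. coeff P n * (c a b * S n a b))"
    by (intro sum.cong refl sum.swap)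
  also have "\<dots> = (\<Sum>n\<le>degree P. \<Sum>a\<in>B. \<Sum>b\<in>B. coeff P n * (c a b * S n a b))"
    by (rule sum.swap)
  also have "\<dots> = (\<Sum>n\<le>degree P. coeff P n *
      (\<Sum>p<n. matrix_pow A p $ u $ i * matrix_pow A (n - Suc p) $ j $ v))"
    unfolding powers by (simp only: sum_distrib_left)
  \<comment> \<open>As \<open>n <= degree P <= m\<close>, the exponents \<open>p\<close> and
    \<open>n - Suc p\<close> add up to \<open>n - 1 < m\<close>, so \<open>zero\<close> applies to
    every term.\<close>
  also have "\<dots> = 0"
    using P(2) deg by (intro sum.neutral ballI mult_eq_0_iff[THEN iffD2] disjI2 zero) auto
  finally have Lpoly: "(\<Sum>a\<in>B. \<Sum>b\<in>B. c a b * divided_difference (poly P) (poly q) (l a) (l b)) = 0" .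
  define g where "g x = exp x - poly P x" for x
  define g' where "g' x = exp x - poly q x" for x
  have diff: "divided_difference g g' x y
      = divided_difference exp exp x y - divided_difference (poly P) (poly q) x y" for x y
    by (simp add: divided_difference_def g_def g'_def diff_divide_distrib)
  have "L_exp A (unit_matrix i j) $ u $ v
      = (\<Sum>a\<in>B. \<Sum>b\<in>B. c a b * divided_difference g g' (l a) (l b))"
    unfolding diff right_diff_distrib sum_subtractf Lpoly L by simp
  also have "\<bar>\<dots>\<bar> \<le> (\<Sum>a\<in>B. \<Sum>b\<in>B. \<bar>c a b\<bar> * M)"
  proof (intro order_trans[OF sum_abs] sum_mono)
    fix a b assume ab: "a \<in> B" "b \<in> B"
    have "\<bar>divided_difference g g' (l a) (l b)\<bar> \<le> M"
    proof (rule abs_divided_difference_le[OF _ _ l[OF ab(1)] l[OF ab(2)]])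
      show "(g has_real_derivative g' z) (at z)" for z
        unfolding g_def g'_def P(1)[symmetric] by (rule DERIV_diff[OF DERIV_exp poly_DERIV])
      show "\<bar>g' z\<bar> \<le> M" if "z \<in> {lambda_min A..lambda_max A}" for z
        using err[OF that] by (simp add: g'_def)
    qed
    then show "\<bar>c a b * divided_difference g g' (l a) (l b)\<bar> \<le> \<bar>c a b\<bar> * M"
      by (simp add: abs_mult mult_left_mono)
  qed
  \<comment> \<open>The coefficients \<open>c a b\<close> factor into a part in \<open>a\<close> and
    a part in \<open>b\<close>, each of absolute sum at most 1.\<close>
  also have "\<dots> = (\<Sum>a\<in>B. \<bar>a $ u * a $ i\<bar>) * (\<Sum>b\<in>B. \<bar>b $ j * b $ v\<bar>) * M"
    unfolding c_def abs_mult[of "_ * _" "_ * _"] sum_product by (simp only: sum_distrib_right)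
  also have "\<dots> \<le> M"
  proof (rule mult_left_le_one_le[OF M])
    show "(\<Sum>a\<in>B. \<bar>a $ u * a $ i\<bar>) * (\<Sum>b\<in>B. \<bar>b $ j * b $ v\<bar>) \<le> 1"
      by (rule mult_le_one[OF le1 sum_nonneg le1]) simp
    show "0 \<le> (\<Sum>a\<in>B. \<bar>a $ u * a $ i\<bar>) * (\<Sum>b\<in>B. \<bar>b $ j * b $ v\<bar>)"
      by (intro mult_nonneg_nonneg sum_nonneg) simp_all
  qed
  finally show ?thesis .
qed

section \<open>Walks and geodesic distance\<close>

text \<open>A nonzero entry of the power must contain a nonzero product of weights along a walk with
  \<open>p\<close> arcs, and removing cycles leaves a path that is no longer.\<close>

lemma geodesic_dist_le:
  assumes G: "weighted_graph G w" and nz: "matrix_pow (adjacency_matrix G w) p $ u $ v \<noteq> 0"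
  shows "geodesic_dist G u v \<le> enat p"
proof -
  have "pair_graph G" and verts: "pverts G = UNIV" using G by (auto simp: weighted_graph_def)
  then interpret pair_graph G by simp
  have "\<exists>es. awalk u es v \<and> length es = p"
    using nz
  proof (induction p arbitrary: u)
    case 0
    then show ?case
      by (intro exI[of _ "[]"]) (auto simp: mat_def awalk_Nil_iff verts split: if_splits)
  next
    case (Suc p)
    then obtain k where k: "adjacency_matrix G w $ u $ k \<noteq> 0"
      "matrix_pow (adjacency_matrix G w) p $ k $ v \<noteq> 0"
      by (auto simp: matrix_matrix_mult_def elim!: sum.not_neutral_contains_not_neutral)
    then obtain es where "awalk k es v" "length es = p" using Suc.IH by blast
    moreover have "(u, k) \<in> parcs G"
      using k(1) by (auto simp: adjacency_matrix_def split: if_splits)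
    ultimately show ?case
      by (intro exI[of _ "(u, k) # es"]) (simp add: awalk_Cons_iff)
  qed
  then obtain es where es: "awalk u es v" "length es = p" by blast
  let ?a = "awalk_to_apath es"
  have apath: "apath u ?a v" by (rule apath_awalk_to_apath[OF es(1)])
  then have "distinct ?a"
    using distinct_verts_imp_distinct by (auto simp: apath_def)
  \<comment> \<open>The arcs of the path are distinct and occur in the walk, so lengths are compared
    through cardinalities.\<close>
  then have "length ?a = card (set ?a)" by (rule distinct_card[symmetric])
  also have "\<dots> \<le> card (set es)"
    by (intro card_mono awalk_to_apath_subset[OF es(1)]) simp
  also have "\<dots> \<le> p" using es(2) card_length by blast
  finally have "enat (length ?a) \<le> enat p" by simp
  moreover have "geodesic_dist G u v \<le> enat (length ?a)"
    unfolding geodesic_dist_def using apath by (intro INF_lower) simp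
  ultimately show ?thesis by (rule order_trans[rotated])
qed

theorem corollary5p6:
  fixes G :: "'n::finite pair_pre_digraph"
    and w :: "'n \<Rightarrow> 'n \<Rightarrow> real"
    and A :: "real^'n^'n"
    and lmin lmax :: real
    and i j u v :: 'n
    and m :: enat
  assumes "weighted_graph G w"
    and "A = adjacency_matrix G w"
    and "lmin = lambda_min A"
    and "lmax = lambda_max A"
    and "m = geodesic_dist G u i + geodesic_dist G j v"
  shows
    \<comment> \<open>\<open>k \<noteq> 0\<close> only excludes the undefined quotient 0/0, which arises for edgeless graphs: it
        follows from the bounds on \<open>k\<close> whenever \<open>lmin < lmax\<close>. For \<open>m = \<infinity>\<close> the second bound is
        read as its limit 0 for \<open>k\<close> tending to infinity.\<close>
    "(\<forall>k::nat. m = enat k \<longrightarrow> k \<noteq> 0 \<longrightarrow>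
        sqrt (lmax - lmin) \<le> real k \<longrightarrow> real k \<le> (lmax - lmin) / 2 \<longrightarrow>
        \<bar>L_exp A (unit_matrix i j) $ u $ v\<bar>
          \<le> 2 * ((lmax - lmin) / real k)
              * exp (lmax - 4 * (real k)\<^sup>2 / (5 * (lmax - lmin)))) \<and>
     (\<forall>k::nat. m = enat k \<longrightarrow> real k > (lmax - lmin) / 2 \<longrightarrow>
        \<bar>L_exp A (unit_matrix i j) $ u $ v\<bar>
          \<le> 8 * (exp lmax * real k / (lmax - lmin))
              * (exp 1 * (lmax - lmin) / (4 * real k + 2 * (lmax - lmin))) ^ k) \<and>
     (m = \<infinity> \<longrightarrow> L_exp A (unit_matrix i j) $ u $ v = 0)"
proof -
  let ?L = "L_exp A (unit_matrix i j) $ u $ v"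
  define D where "D = lmax - lmin"
  have "pair_graph G" and w: "\<And>a b. (a, b) \<in> parcs G \<Longrightarrow> w a b = w b a"
    using assms(1) by (auto simp: weighted_graph_def)
  then interpret pair_graph G by simp
  have arcs: "(a, b) \<in> parcs G \<longleftrightarrow> (b, a) \<in> parcs G" for a b
    using arcs_symmetric by blast
  have sym: "transpose A = A"
    using w by (auto simp: assms(2) transpose_def adjacency_matrix_def vec_eq_iff arcs)
  have lr: "lmin \<le> lmax"
  proof -
    obtain B :: "(real^'n) set" and l where "finite B" "B \<noteq> {}" "eigenvalues A = l ` B"
      by (rule symmetric_matrix_spectral_decomposition[OF sym]) (rule that)
    then obtain b where "b \<in> eigenvalues A" "finite (eigenvalues A)" by auto
    then show ?thesis
      unfolding assms(3,4) lambda_min_def lambda_max_def by (meson Min_le Max_ge order_trans)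
  qed
  \<comment> \<open>If both factors were nonzero, \<open>p\<close> and \<open>q\<close> would be at
    least the two distances, whose sum is \<open>m\<close>.\<close>
  have zero: "matrix_pow A p $ u $ i * matrix_pow A q $ j $ v = 0" if "enat (p + q) < m" for p q
  proof (rule ccontr)
    assume "matrix_pow A p $ u $ i * matrix_pow A q $ j $ v \<noteq> 0"
    then have "geodesic_dist G u i \<le> enat p" "geodesic_dist G j v \<le> enat q"
      using geodesic_dist_le[OF assms(1)] by (auto simp: assms(2))
    then have "m \<le> enat p + enat q" unfolding assms(5) by (rule add_mono)
    then show False using that by simp
  qed
  have bound: "\<bar>?L\<bar> \<le> 2 * exp (lmax - D / 2 + D / 4 * (r + 1 / r)) / r ^ k"
    if k: "m = enat k" "k > 0" and r: "r \<ge> 1" for k r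
  \<comment> \<open>The approximation error carries an arbitrary \<open>e > 0\<close>, removed
    here.\<close>
  proof (rule field_le_epsilon)
    fix e :: real assume "e > 0"
    obtain q where q: "degree q < k" "\<And>x. x \<in> {lmin..lmax} \<Longrightarrow>
        \<bar>exp x - poly q x\<bar> \<le> 2 * exp (lmax - D / 2 + D / 4 * (r + 1 / r)) / r ^ k + e"
      using exp_poly_approx[OF lr r k(2) \<open>e > 0\<close>] unfolding D_def by blast
    then show "\<bar>?L\<bar> \<le> 2 * exp (lmax - D / 2 + D / 4 * (r + 1 / r)) / r ^ k + e"
      using zero k(1) unfolding assms(3,4)
      by (intro L_exp_unit_matrix_le_approx_error[OF sym, of k]) auto
  qed
  have "\<bar>?L\<bar> \<le> 2 * (D / real k) * exp (lmax - 4 * (real k)\<^sup>2 / (5 * D))"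
    if "m = enat k" "k \<noteq> 0" "real k \<le> D / 2" for k
  proof (rule order_trans[OF bound chernoff_bound_small[OF refl]])
    show "1 \<le> 1 + 2 * real k / D" using that by (simp add: zero_le_divide_iff)
  qed (use that in auto)
  moreover have "\<bar>?L\<bar> \<le> 8 * (exp lmax * real k / D) * (exp 1 * D / (4 * real k + 2 * D)) ^ k"
    if k: "m = enat k" "real k > D / 2" for k
  proof (cases "D = 0")
    \<comment> \<open>Division by \<open>D = 0\<close> makes the right side 0. The left side is 0 as
      well: every eigenvalue equals \<open>lmax\<close>, where the constant \<open>exp lmax\<close>
      approximates \<open>exp\<close> without error.\<close>
    case True
    have "k > 0" using k True by simp
    have "\<bar>?L\<bar> \<le> 0"
      using zero k(1) True \<open>k > 0\<close>
      by (intro L_exp_unit_matrix_le_approx_error[OF sym, of k _ _ _ _ "[:exp lmax:]"])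
        (auto simp: D_def assms(3,4))
    then show ?thesis using True by simp
  next
    case False
    then have "D > 0" using lr by (simp add: D_def)
    moreover from this have "k > 0" using k(2) by (auto intro!: Nat.gr0I)
    ultimately show ?thesis
      by (intro order_trans[OF bound chernoff_bound_large[OF refl]]) (use k in auto)
  qed
  \<comment> \<open>For infinite \<open>m\<close>, every term of the series for the entry vanishes
    by \<open>zero\<close>.\<close>
  moreover have "?L = 0" if "m = \<infinity>"
  proof -
    have "(\<Sum>p<n. matrix_pow A p $ u $ i * matrix_pow A (n - Suc p) $ j $ v) = 0" for n
      using zero that by (intro sum.neutral) simp
    then have "(\<lambda>n. 0) sums ?L"
      using L_exp_unit_matrix_sums[of A u i j v] by simp
    then show ?thesis by (rule sums_unique2[OF _ sums_zero])
  qed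
  ultimately show ?thesis unfolding D_def by blast
qed

end
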